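(* Let $(V_4,g)$ be a $4$-dimensional $W$-flat spacetime (i.e. $W_{abcd}=0$) satisfying the Einstein field equations with a cosmological term, $R_{bc}-\frac12 R g_{bc}+\Lambda g_{bc}=k\,T_{bc}$, with perfect fluid energy-momentum tensor $T_{bc}=(\mu+p)u_bu_c+p\,g_{bc}$. Then the matter content obeys the vacuum-like equation of state $\mu+p=0$.
   Context: A spacetime $V_4$ is a $4$-dimensional Lorentzian manifold with metric $g_{ab}$ of signature $(-,+,+,+)$ and Levi-Civita connection $\nabla$. The Riemann tensor is $R(X,Y,Z,T)=g(\nabla_X\nabla_YZ-\nabla_Y\nabla_XZ-\nabla_{[X,Y]}Z,T)$, with components $R_{abcd}$; the Ricci tensor is $R_{bc}=g^{ad}R_{abcd}$ and the scalar curvature is $R=g^{bc}R_{bc}$. The $W$-curvature tensor of $V_4$ is $W_{abcd}=R_{abcd}+\frac13\left[g_{ac}R_{bd}-g_{bc}R_{ad}\right]$. The spacetime is called $W$-flat if $W_{abcd}=0$ everywhere. $\Lambda$ is the cosmological constant and $k$ is the non-zero gravitational constant. In the perfect fluid tensor, $\mu$ (energy density) and $p$ (isotropic pressure) are scalar functions and $u^a$ is the fluid velocity vector field, with $u_a=g_{ab}u^b$ and $u_au^a=-1$. The vacuum-like equation of state is $\mu+p=0$ (this includes the empty case $\mu=p=0$). *)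

theory Defs
  imports "HOL-Analysis.Analysis"
begin

section \<open>Smooth functions on open subsets of normed spaces\<close>

text \<open>These predicates are only meaningful, and only used below, for open \<open>S\<close>.\<close>

primrec Ck_on :: "nat \<Rightarrow> 'a::real_normed_vector set \<Rightarrow> ('a \<Rightarrow> 'b::real_normed_vector) \<Rightarrow> bool"
  where
    "Ck_on 0 S f \<longleftrightarrow> continuous_on S f"
  | "Ck_on (Suc k) S f \<longleftrightarrow>
       (\<forall>x\<in>S. f differentiable (at x)) \<and>
       (\<forall>v. Ck_on k S (\<lambda>x. frechet_derivative f (at x) v))"

definition smooth_on :: "'a::real_normed_vector set \<Rightarrow> ('a \<Rightarrow> 'b::real_normed_vector) \<Rightarrow> bool"
  where "smooth_on S f \<longleftrightarrow> (\<forall>k. Ck_on k S f)"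


section \<open>Four-dimensional smooth manifolds\<close>

text \<open>
  A manifold is given by a smooth atlas \<open>A\<close> on a Hausdorff, second countable type; its point set
  \<open>carrier_of A\<close> is the union of the chart domains. The atlas need not be maximal.
\<close>

type_synonym 'a chart = "'a set \<times> ('a \<Rightarrow> real^4)"

definition carrier_of :: "'a chart set \<Rightarrow> 'a set"
  where "carrier_of A = (\<Union>(U, \<phi>)\<in>A. U)"

definition is_chart :: "'a::topological_space chart \<Rightarrow> bool"
  where "is_chart c \<longleftrightarrow> (case c of (U, \<phi>) \<Rightarrow>
           open U \<and> open (\<phi> ` U) \<and> homeomorphism U (\<phi> ` U) \<phi> (inv_into U \<phi>))"

definition smooth_manifold4 :: "'a::{t2_space, second_countable_topology} chart set \<Rightarrow> bool"
  where "smooth_manifold4 A \<longleftrightarrow>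
           (\<forall>c\<in>A. is_chart c) \<and>
           (\<forall>(U, \<phi>)\<in>A. \<forall>(V, \<psi>)\<in>A. smooth_on (\<phi> ` (U \<inter> V)) (\<psi> \<circ> inv_into U \<phi>))"

definition smooth_fun_on :: "'a::topological_space chart set \<Rightarrow> 'a set \<Rightarrow> ('a \<Rightarrow> real) \<Rightarrow> bool"
  where "smooth_fun_on A V f \<longleftrightarrow>
           (\<forall>(U, \<phi>)\<in>A. smooth_on (\<phi> ` (U \<inter> V)) (f \<circ> inv_into U \<phi>))"

definition smooth_near :: "'a::topological_space chart set \<Rightarrow> 'a \<Rightarrow> ('a \<Rightarrow> real) \<Rightarrow> bool"
  where "smooth_near A x f \<longleftrightarrow>
           (\<exists>V. open V \<and> x \<in> V \<and> V \<subseteq> carrier_of A \<and> smooth_fun_on A V f)"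


section \<open>Tangent vectors and vector fields\<close>

text \<open>
  A tangent vector at \<open>x\<close> is a derivation at \<open>x\<close> of the germs of smooth functions. It is
  represented by a total function on \<open>'a \<Rightarrow> real\<close> that vanishes on functions not smooth near \<open>x\<close>,
  so that equality of tangent vectors is equality in HOL. The operations on tangent vectors and
  on vector fields below are the pointwise ones.
\<close>

type_synonym 'a tvector = "('a \<Rightarrow> real) \<Rightarrow> real"
type_synonym 'a vfield = "'a \<Rightarrow> 'a tvector"

definition tangent_space :: "'a::topological_space chart set \<Rightarrow> 'a \<Rightarrow> 'a tvector set"
  where "tangent_space A x = {v.
           (\<forall>f. \<not> smooth_near A x f \<longrightarrow> v f = 0) \<and>
           (\<forall>f h V. smooth_near A x f \<and> open V \<and> x \<in> V \<and> (\<forall>q\<in>V. f q = h q) \<longrightarrow> v f = v h) \<and>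
           (\<forall>a f. smooth_near A x f \<longrightarrow> v (\<lambda>q. a * f q) = a * v f) \<and>
           (\<forall>f h. smooth_near A x f \<and> smooth_near A x h \<longrightarrow>
              v (\<lambda>q. f q + h q) = v f + v h \<and>
              v (\<lambda>q. f q * h q) = f x * v h + h x * v f)}"

definition tv_add :: "'a tvector \<Rightarrow> 'a tvector \<Rightarrow> 'a tvector"
  where "tv_add v w = (\<lambda>f. v f + w f)"

definition tv_diff :: "'a tvector \<Rightarrow> 'a tvector \<Rightarrow> 'a tvector"
  where "tv_diff v w = (\<lambda>f. v f - w f)"

definition tv_scale :: "real \<Rightarrow> 'a tvector \<Rightarrow> 'a tvector"
  where "tv_scale a v = (\<lambda>f. a * v f)"

definition smooth_vfield_on :: "'a::topological_space chart set \<Rightarrow> 'a set \<Rightarrow> 'a vfield \<Rightarrow> bool"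
  where "smooth_vfield_on A U X \<longleftrightarrow>
           (\<forall>x\<in>U. X x \<in> tangent_space A x) \<and>
           (\<forall>V f. open V \<and> V \<subseteq> U \<and> smooth_fun_on A V f \<longrightarrow> smooth_fun_on A V (\<lambda>x. X x f))"

text \<open>
  The guard restores the convention that tangent vectors vanish on functions that are not smooth
  near the point; on smooth functions this is \<open>[X, Y] f = X (Y f) - Y (X f)\<close>.
\<close>

definition lie_bracket :: "'a::topological_space chart set \<Rightarrow> 'a vfield \<Rightarrow> 'a vfield \<Rightarrow> 'a vfield"
  where "lie_bracket A X Y = (\<lambda>x f.
           if smooth_near A x f then X x (\<lambda>q. Y q f) - Y x (\<lambda>q. X q f) else 0)"

definition coord_field :: "'a::topological_space chart set \<Rightarrow> 'a chart \<Rightarrow> 4 \<Rightarrow> 'a vfield"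
  where "coord_field A c a = (\<lambda>x f.
           if smooth_near A x f
           then frechet_derivative (f \<circ> inv_into (fst c) (snd c)) (at (snd c x)) (axis a 1)
           else 0)"


section \<open>Lorentzian metrics and the Levi-Civita connection\<close>

type_synonym 'a metric = "'a \<Rightarrow> 'a tvector \<Rightarrow> 'a tvector \<Rightarrow> real"

text \<open>Signature \<open>(-,+,+,+)\<close>, with \<open>0 :: 4\<close> as the time index.\<close>

definition minkowski :: "4 \<Rightarrow> 4 \<Rightarrow> real"
  where "minkowski a b = (if a \<noteq> b then 0 else if a = 0 then - 1 else 1)"

definition lorentzian_metric :: "'a::topological_space chart set \<Rightarrow> 'a metric \<Rightarrow> bool"
  where "lorentzian_metric A g \<longleftrightarrow>
           (\<forall>x\<in>carrier_of A.
              (\<forall>v\<in>tangent_space A x. \<forall>w\<in>tangent_space A x. g x v w = g x w v) \<and>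
              (\<forall>v\<in>tangent_space A x. \<forall>v'\<in>tangent_space A x. \<forall>w\<in>tangent_space A x.
                 g x (tv_add v v') w = g x v w + g x v' w) \<and>
              (\<forall>a. \<forall>v\<in>tangent_space A x. \<forall>w\<in>tangent_space A x.
                 g x (tv_scale a v) w = a * g x v w) \<and>
              (\<exists>e :: 4 \<Rightarrow> 'a tvector.
                 (\<forall>a. e a \<in> tangent_space A x) \<and>
                 (\<forall>v\<in>tangent_space A x. \<exists>!c :: real^4. v = (\<lambda>f. \<Sum>a\<in>UNIV. c $ a * e a f)) \<and>
                 (\<forall>a b. g x (e a) (e b) = minkowski a b))) \<and>
           (\<forall>U X Y. open U \<and> U \<subseteq> carrier_of A \<and> smooth_vfield_on A U X \<and> smooth_vfield_on A U Y
              \<longrightarrow> smooth_fun_on A U (\<lambda>x. g x (X x) (Y x)))"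

type_synonym 'a connection = "'a vfield \<Rightarrow> 'a vfield \<Rightarrow> 'a vfield"

text \<open>
  \<open>D X Y\<close> is the covariant derivative of \<open>Y\<close> along \<open>X\<close>. Connections act on vector fields that are
  smooth on an arbitrary open subset of the manifold, compatibly with restriction (last
  conjunct), so that they can be applied to the coordinate fields of a chart.
\<close>

definition affine_connection :: "'a::topological_space chart set \<Rightarrow> 'a connection \<Rightarrow> bool"
  where "affine_connection A D \<longleftrightarrow>
           (\<forall>U X Y Z h. open U \<and> U \<subseteq> carrier_of A \<and> smooth_vfield_on A U X \<and>
              smooth_vfield_on A U Y \<and> smooth_vfield_on A U Z \<and> smooth_fun_on A U h \<longrightarrow>
              smooth_vfield_on A U (D X Y) \<and>
              (\<forall>x\<in>U.
                 D (\<lambda>q. tv_add (X q) (Y q)) Z x = tv_add (D X Z x) (D Y Z x) \<and>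
                 D (\<lambda>q. tv_scale (h q) (X q)) Y x = tv_scale (h x) (D X Y x) \<and>
                 D X (\<lambda>q. tv_add (Y q) (Z q)) x = tv_add (D X Y x) (D X Z x) \<and>
                 D X (\<lambda>q. tv_scale (h q) (Y q)) x =
                   tv_add (tv_scale (X x h) (Y x)) (tv_scale (h x) (D X Y x)))) \<and>
           (\<forall>U X X' Y Y'. open U \<and> U \<subseteq> carrier_of A \<and> smooth_vfield_on A U X \<and>
              smooth_vfield_on A U Y \<and> (\<forall>x\<in>U. X x = X' x \<and> Y x = Y' x) \<longrightarrow>
              (\<forall>x\<in>U. D X Y x = D X' Y' x))"

definition levi_civita :: "'a::topological_space chart set \<Rightarrow> 'a metric \<Rightarrow> 'a connection \<Rightarrow> bool"
  where "levi_civita A g D \<longleftrightarrow>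
           affine_connection A D \<and>
           (\<forall>U X Y Z. open U \<and> U \<subseteq> carrier_of A \<and> smooth_vfield_on A U X \<and>
              smooth_vfield_on A U Y \<and> smooth_vfield_on A U Z \<longrightarrow>
              (\<forall>x\<in>U.
                 tv_diff (D X Y x) (D Y X x) = lie_bracket A X Y x \<and>
                 X x (\<lambda>q. g q (Y q) (Z q)) = g x (D X Y x) (Z x) + g x (Y x) (D X Z x)))"


section \<open>Curvature\<close>

definition riemann ::
    "'a::topological_space chart set \<Rightarrow> 'a metric \<Rightarrow> 'a connection \<Rightarrow>
     'a vfield \<Rightarrow> 'a vfield \<Rightarrow> 'a vfield \<Rightarrow> 'a vfield \<Rightarrow> 'a \<Rightarrow> real"
  where "riemann A g D X Y Z T x =
           g x (tv_diff (tv_diff (D X (D Y Z) x) (D Y (D X Z) x)) (D (lie_bracket A X Y) Z x)) (T x)"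

text \<open>Components are taken with respect to the coordinate fields of a chart \<open>c\<close>, at a point \<open>x\<close>.\<close>

definition metric_lo ::
    "'a::topological_space chart set \<Rightarrow> 'a metric \<Rightarrow> 'a chart \<Rightarrow> 'a \<Rightarrow> real^4^4"
  where "metric_lo A g c x = (\<chi> a b. g x (coord_field A c a x) (coord_field A c b x))"

definition metric_up ::
    "'a::topological_space chart set \<Rightarrow> 'a metric \<Rightarrow> 'a chart \<Rightarrow> 'a \<Rightarrow> real^4^4"
  where "metric_up A g c x = matrix_inv (metric_lo A g c x)"

definition Riem ::
    "'a::topological_space chart set \<Rightarrow> 'a metric \<Rightarrow> 'a connection \<Rightarrow> 'a chart \<Rightarrow> 'a \<Rightarrow>
     4 \<Rightarrow> 4 \<Rightarrow> 4 \<Rightarrow> 4 \<Rightarrow> real"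
  where "Riem A g D c x a b i j =
           riemann A g D (coord_field A c a) (coord_field A c b)
             (coord_field A c i) (coord_field A c j) x"

definition Ricci ::
    "'a::topological_space chart set \<Rightarrow> 'a metric \<Rightarrow> 'a connection \<Rightarrow> 'a chart \<Rightarrow> 'a \<Rightarrow>
     4 \<Rightarrow> 4 \<Rightarrow> real"
  where "Ricci A g D c x b i =
           (\<Sum>a\<in>UNIV. \<Sum>j\<in>UNIV. metric_up A g c x $ a $ j * Riem A g D c x a b i j)"

definition scalar_curvature ::
    "'a::topological_space chart set \<Rightarrow> 'a metric \<Rightarrow> 'a connection \<Rightarrow> 'a chart \<Rightarrow> 'a \<Rightarrow> real"
  where "scalar_curvature A g D c x =
           (\<Sum>b\<in>UNIV. \<Sum>i\<in>UNIV. metric_up A g c x $ b $ i * Ricci A g D c x b i)"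

definition W_curvature ::
    "'a::topological_space chart set \<Rightarrow> 'a metric \<Rightarrow> 'a connection \<Rightarrow> 'a chart \<Rightarrow> 'a \<Rightarrow>
     4 \<Rightarrow> 4 \<Rightarrow> 4 \<Rightarrow> 4 \<Rightarrow> real"
  where "W_curvature A g D c x a b i j =
           Riem A g D c x a b i j +
           1 / 3 * (metric_lo A g c x $ a $ i * Ricci A g D c x b j -
                    metric_lo A g c x $ b $ i * Ricci A g D c x a j)"

definition W_flat :: "'a::topological_space chart set \<Rightarrow> 'a metric \<Rightarrow> 'a connection \<Rightarrow> bool"
  where "W_flat A g D \<longleftrightarrow>
           (\<forall>c\<in>A. \<forall>x\<in>fst c. \<forall>a b i j. W_curvature A g D c x a b i j = 0)"


section \<open>Perfect fluids and the Einstein field equations\<close>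

definition vec_up :: "'a vfield \<Rightarrow> 'a chart \<Rightarrow> 'a \<Rightarrow> 4 \<Rightarrow> real"
  where "vec_up u c x a = u x (\<lambda>q. snd c q $ a)"

definition vec_lo ::
    "'a::topological_space chart set \<Rightarrow> 'a metric \<Rightarrow> 'a vfield \<Rightarrow> 'a chart \<Rightarrow> 'a \<Rightarrow> 4 \<Rightarrow> real"
  where "vec_lo A g u c x a = (\<Sum>b\<in>UNIV. metric_lo A g c x $ a $ b * vec_up u c x b)"

definition fluid_velocity ::
    "'a::topological_space chart set \<Rightarrow> 'a metric \<Rightarrow> 'a vfield \<Rightarrow> bool"
  where "fluid_velocity A g u \<longleftrightarrow>
           smooth_vfield_on A (carrier_of A) u \<and>
           (\<forall>c\<in>A. \<forall>x\<in>fst c. (\<Sum>a\<in>UNIV. vec_lo A g u c x a * vec_up u c x a) = - 1)"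

definition perfect_fluid ::
    "'a::topological_space chart set \<Rightarrow> 'a metric \<Rightarrow> ('a \<Rightarrow> real) \<Rightarrow> ('a \<Rightarrow> real) \<Rightarrow> 'a vfield \<Rightarrow>
     'a chart \<Rightarrow> 'a \<Rightarrow> 4 \<Rightarrow> 4 \<Rightarrow> real"
  where "perfect_fluid A g \<mu> p u c x b i =
           (\<mu> x + p x) * vec_lo A g u c x b * vec_lo A g u c x i + p x * metric_lo A g c x $ b $ i"

definition einstein_equations ::
    "'a::topological_space chart set \<Rightarrow> 'a metric \<Rightarrow> 'a connection \<Rightarrow> real \<Rightarrow> real \<Rightarrow>
     ('a chart \<Rightarrow> 'a \<Rightarrow> 4 \<Rightarrow> 4 \<Rightarrow> real) \<Rightarrow> bool"
  where "einstein_equations A g D \<Lambda> k T \<longleftrightarrow>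
           (\<forall>c\<in>A. \<forall>x\<in>fst c. \<forall>b i.
              Ricci A g D c x b i - 1 / 2 * scalar_curvature A g D c x * metric_lo A g c x $ b $ i
                + \<Lambda> * metric_lo A g c x $ b $ i = k * T c x b i)"

end

theory Submission
  imports Defs
begin

text \<open>
  The Riemann tensor is skew in its last two indices. Symmetrizing \<open>W\<^sub>a\<^sub>b\<^sub>i\<^sub>j = 0\<close> in \<open>i, j\<close> therefore
  leaves an identity in the metric and the Ricci tensor only, whose contraction with \<open>g\<^sup>a\<^sup>i\<close> is the
  Einstein condition \<open>4 R\<^sub>b\<^sub>j = R g\<^sub>b\<^sub>j\<close>. The field equations then equate a multiple of \<open>g\<^sub>b\<^sub>i\<close> with
  \<open>k (\<mu> + p) u\<^sub>b u\<^sub>i\<close>; since \<open>g\<close> has rank 4, both sides vanish.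
\<close>

section \<open>Calculus of smooth functions\<close>

text \<open>The skew symmetry comes from metric compatibility, which is available only for fields
  smooth on an open set. Components refer to coordinate fields, so much of the work lies in showing
  that these are smooth fields of derivations; as charts overlap, this calls for the chain rule at
  every order. Likewise the inverse metric is a \<open>matrix_inv\<close>, which has meaning only
  once the matrix of the metric is invertible, and this is drawn from the signature. The contraction
  turns the four terms of the symmetrized identity into \<open>4 R\<^sub>b\<^sub>j\<close>,
  \<open>- R\<^sub>b\<^sub>j\<close>, \<open>R\<^sub>b\<^sub>j\<close> and
  \<open>- R g\<^sub>b\<^sub>j\<close>, whence the factor 4. The rank argument is made by
  contracting one identity twice, with the inverse metric and with the velocity.\<close>

lemma Ck_on_SucD:
  assumes "Ck_on (Suc k) S f" "x \<in> S"
  shows "(f has_derivative frechet_derivative f (at x)) (at x)"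
  using assms by (simp add: frechet_derivative_works)

text \<open>Differentiability at a point of an open set depends only on the germ, so the derivatives
  of \<open>f\<close> and \<open>g\<close> agree on all of \<open>S\<close> and the induction
  hypothesis applies to them.\<close>

lemma Ck_on_cong:
  assumes "open S" "\<And>x. x \<in> S \<Longrightarrow> f x = g x" "Ck_on k S f"
  shows "Ck_on k S g"
  using assms(2,3)
proof (induction k arbitrary: f g)
  case 0
  then show ?case using continuous_on_cong[of S S f g] by simp
next
  case (Suc k)
  have g': "(g has_derivative frechet_derivative f (at x)) (at x)" if "x \<in> S" for x
    using has_derivative_transform_within_open[OF Ck_on_SucD[OF Suc.prems(2) that] \<open>open S\<close> that]
      Suc.prems(1) by simp
  have "Ck_on k S (\<lambda>x. frechet_derivative g (at x) v)" for v
  proof (rule Suc.IH)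
    show "frechet_derivative f (at x) v = frechet_derivative g (at x) v" if "x \<in> S" for x
      by (simp add: frechet_derivative_at[OF g'[OF that]])
    show "Ck_on k S (\<lambda>x. frechet_derivative f (at x) v)"
      using Suc.prems(2) by simp
  qed
  then show ?case
    using g' by (auto simp: differentiable_def)
qed

text \<open>\<open>frechet_derivative\<close> is a choice operator; by uniqueness of derivatives an
  explicit formula \<open>f'\<close> may stand in for it, which is how the differentiation rules
  enter below.\<close>

lemma Ck_on_SucI:
  assumes "open S" "\<And>x. x \<in> S \<Longrightarrow> (f has_derivative f' x) (at x)"
    and "\<And>v. Ck_on k S (\<lambda>x. f' x v)"
  shows "Ck_on (Suc k) S f"
proof -
  have "Ck_on k S (\<lambda>x. frechet_derivative f (at x) v)" for v
    by (rule Ck_on_cong[OF assms(1) _ assms(3)[of v]])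
      (simp add: frechet_derivative_at[OF assms(2)])
  then show ?thesis
    using assms(2) by (auto simp: differentiable_def)
qed

lemma Ck_on_subset: "Ck_on k S f \<Longrightarrow> T \<subseteq> S \<Longrightarrow> Ck_on k T f"
  by (induction k arbitrary: f) (auto intro: continuous_on_subset)

lemma Ck_on_SucE: "Ck_on (Suc k) S f \<Longrightarrow> Ck_on k S f"
  by (induction k arbitrary: f)
    (auto intro!: continuous_at_imp_continuous_on differentiable_imp_continuous_within)

lemma Ck_on_const:
  assumes "open S"
  shows "Ck_on k S (\<lambda>x. c)"
proof (induction k arbitrary: c)
  case (Suc k)
  show ?case
    by (rule Ck_on_SucI[OF assms has_derivative_const Suc])
qed simp

lemma Ck_on_add:
  assumes "open S" "Ck_on k S f" "Ck_on k S g"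
  shows "Ck_on k S (\<lambda>x. f x + g x)"
  using assms(2,3)
proof (induction k arbitrary: f g)
  case (Suc k)
  show ?case
  proof (rule Ck_on_SucI[OF assms(1)])
    show "((\<lambda>x. f x + g x) has_derivative
        (\<lambda>v. frechet_derivative f (at x) v + frechet_derivative g (at x) v)) (at x)"
      if "x \<in> S" for x
      using has_derivative_add[OF Ck_on_SucD[OF Suc.prems(1) that] Ck_on_SucD[OF Suc.prems(2) that]] .
    show "Ck_on k S (\<lambda>x. frechet_derivative f (at x) v + frechet_derivative g (at x) v)" for v
      using Suc by simp
  qed
qed (simp add: continuous_on_add)

lemma Ck_on_sum:
  assumes "open S" "\<And>i. i \<in> I \<Longrightarrow> Ck_on k S (f i)"
  shows "Ck_on k S (\<lambda>x. \<Sum>i\<in>I. f i x)"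
  using assms(2)
  by (induction I rule: infinite_finite_induct) (simp_all add: Ck_on_const Ck_on_add assms(1))

lemma Ck_on_bounded_linear:
  assumes "open S" "bounded_linear L" "Ck_on k S f"
  shows "Ck_on k S (\<lambda>x. L (f x))"
  using assms(3)
proof (induction k arbitrary: f)
  case 0
  then show ?case using assms(2) by (simp add: bounded_linear.continuous_on)
next
  case (Suc k)
  show ?case
  proof (rule Ck_on_SucI[OF assms(1)])
    show "((\<lambda>x. L (f x)) has_derivative (\<lambda>v. L (frechet_derivative f (at x) v))) (at x)"
      if "x \<in> S" for x
      using bounded_linear.has_derivative[OF assms(2) Ck_on_SucD[OF Suc.prems that]] .
    show "Ck_on k S (\<lambda>x. L (frechet_derivative f (at x) v))" for v
      using Suc by simp
  qed
qed

text \<open>The product rule leaves one factor undifferentiated in each summand. That factor has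
  order \<open>Suc k\<close>, so its order is lowered before the induction hypothesis is
  applied.\<close>

lemma Ck_on_scaleR:
  assumes "open S" "Ck_on k S f" "Ck_on k S g"
  shows "Ck_on k S (\<lambda>x. f x *\<^sub>R g x)"
  using assms(2,3)
proof (induction k arbitrary: f g)
  case 0
  then show ?case by (simp add: continuous_on_scaleR)
next
  case (Suc k)
  show ?case
  proof (rule Ck_on_SucI[OF assms(1)])
    show "((\<lambda>x. f x *\<^sub>R g x) has_derivative
        (\<lambda>v. f x *\<^sub>R frechet_derivative g (at x) v + frechet_derivative f (at x) v *\<^sub>R g x)) (at x)"
      if "x \<in> S" for x
      using has_derivative_scaleR[OF Ck_on_SucD[OF Suc.prems(1) that] Ck_on_SucD[OF Suc.prems(2) that]] .
    show "Ck_on k S (\<lambda>x. f x *\<^sub>R frechet_derivative g (at x) v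
        + frechet_derivative f (at x) v *\<^sub>R g x)" for v
    proof (rule Ck_on_add[OF assms(1)]; rule Suc.IH)
      show "Ck_on k S f" "Ck_on k S g" using Suc.prems Ck_on_SucE by blast+
    qed (use Suc.prems in simp_all)
  qed
qed

text \<open>
  The derivative of \<open>h\<close> is expanded over a basis, so that the chain rule expresses the derivative
  of \<open>h \<circ> f\<close> as a sum of products to which the induction hypothesis applies.
\<close>

lemma Ck_on_compose:
  fixes f :: "'a::real_normed_vector \<Rightarrow> 'b::euclidean_space"
    and h :: "'b \<Rightarrow> 'c::real_normed_vector"
  assumes "open S" "open T" "f ` S \<subseteq> T" "Ck_on k S f" "Ck_on k T h"
  shows "Ck_on k S (\<lambda>x. h (f x))"
  using assms(4,5)
proof (induction k arbitrary: h)
  case 0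
  then show ?case
    using continuous_on_compose2[of T h S f] assms(3) by simp
next
  case (Suc k)
  let ?f' = "\<lambda>x. frechet_derivative f (at x)" and ?h' = "\<lambda>y. frechet_derivative h (at y)"
  have Ckf: "Ck_on k S f" using Suc.prems(1) Ck_on_SucE by blast
  show ?case
  proof (rule Ck_on_SucI[OF assms(1)])
    fix x assume x: "x \<in> S"
    then have fx: "f x \<in> T" using assms(3) by blast
    have h: "(h has_derivative ?h' (f x)) (at (f x))" by (rule Ck_on_SucD[OF Suc.prems(2) fx])
    then have "linear (?h' (f x))" by (rule has_derivative_linear)
    then have "?h' (f x) (\<Sum>b\<in>Basis. (w \<bullet> b) *\<^sub>R b) = (\<Sum>b\<in>Basis. (w \<bullet> b) *\<^sub>R ?h' (f x) b)" for w
      by (simp add: linear_sum linear_scale)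
    then have expand: "?h' (f x) w = (\<Sum>b\<in>Basis. (w \<bullet> b) *\<^sub>R ?h' (f x) b)" for w
      unfolding euclidean_representation .
    show "((\<lambda>x. h (f x)) has_derivative
        (\<lambda>v. \<Sum>b\<in>Basis. (?f' x v \<bullet> b) *\<^sub>R ?h' (f x) b)) (at x)"
      using has_derivative_compose[OF Ck_on_SucD[OF Suc.prems(1) x] h]
      unfolding expand[of "?f' x _"] .
  next
    fix v
    show "Ck_on k S (\<lambda>x. \<Sum>b\<in>Basis. (?f' x v \<bullet> b) *\<^sub>R ?h' (f x) b)"
    proof (rule Ck_on_sum[OF assms(1)], rule Ck_on_scaleR[OF assms(1)])
      fix b
      show "Ck_on k S (\<lambda>x. ?f' x v \<bullet> b)"
        by (rule Ck_on_bounded_linear[OF assms(1) bounded_linear_inner_left])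
          (use Suc.prems(1) in simp)
      show "Ck_on k S (\<lambda>x. ?h' (f x) b)"
        by (rule Suc.IH[OF Ckf]) (use Suc.prems(2) in simp)
    qed
  qed
qed

section \<open>Closure properties of smooth maps between normed spaces\<close>

lemma smooth_on_cong:
  "open S \<Longrightarrow> (\<And>x. x \<in> S \<Longrightarrow> f x = g x) \<Longrightarrow> smooth_on S f \<Longrightarrow> smooth_on S g"
  unfolding smooth_on_def using Ck_on_cong by blast

lemma smooth_on_subset: "smooth_on S f \<Longrightarrow> T \<subseteq> S \<Longrightarrow> smooth_on T f"
  unfolding smooth_on_def using Ck_on_subset by blast

lemma smooth_on_const: "open S \<Longrightarrow> smooth_on S (\<lambda>x. c)"
  unfolding smooth_on_def using Ck_on_const by blast

lemma smooth_on_add: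
  "open S \<Longrightarrow> smooth_on S f \<Longrightarrow> smooth_on S g \<Longrightarrow> smooth_on S (\<lambda>x. f x + g x)"
  unfolding smooth_on_def using Ck_on_add by blast

lemma smooth_on_mult:
  fixes f g :: "'a::real_normed_vector \<Rightarrow> real"
  shows "open S \<Longrightarrow> smooth_on S f \<Longrightarrow> smooth_on S g \<Longrightarrow> smooth_on S (\<lambda>x. f x * g x)"
  unfolding smooth_on_def using Ck_on_scaleR[of S _ f g] by simp

lemma smooth_on_bounded_linear:
  "open S \<Longrightarrow> bounded_linear L \<Longrightarrow> smooth_on S f \<Longrightarrow> smooth_on S (\<lambda>x. L (f x))"
  unfolding smooth_on_def using Ck_on_bounded_linear by blast

lemma smooth_on_compose:
  fixes f :: "'a::real_normed_vector \<Rightarrow> 'b::euclidean_space"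
  shows "open S \<Longrightarrow> open T \<Longrightarrow> f ` S \<subseteq> T \<Longrightarrow> smooth_on S f \<Longrightarrow> smooth_on T h
    \<Longrightarrow> smooth_on S (\<lambda>x. h (f x))"
  unfolding smooth_on_def using Ck_on_compose by blast

lemma smooth_on_derivative: "smooth_on S f \<Longrightarrow> smooth_on S (\<lambda>x. frechet_derivative f (at x) v)"
  unfolding smooth_on_def by (metis Ck_on.simps(2))

lemma smooth_on_differentiable: "smooth_on S f \<Longrightarrow> x \<in> S \<Longrightarrow> f differentiable (at x)"
  unfolding smooth_on_def by (metis Ck_on.simps(2))


section \<open>Smooth functions on a manifold\<close>

lemma chart_open_image:
  assumes "is_chart (U, \<phi>)" "open V"
  shows "open (\<phi> ` (U \<inter> V))"
proof -
  have "homeomorphism U (\<phi> ` U) \<phi> (inv_into U \<phi>)" "open (\<phi> ` U)" "open U"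
    using assms(1) by (auto simp: is_chart_def)
  then show ?thesis
    using homeomorphism_imp_open_map[of U "\<phi> ` U" \<phi> _ "U \<inter> V"] assms(2)
    by (metis inf_le1 open_Int openin_open_eq)
qed

lemma chart_inj:
  assumes "is_chart (U, \<phi>)"
  shows "inj_on \<phi> U"
  using assms by (force simp: is_chart_def homeomorphism_def intro: inj_on_inverseI)

lemma chart_in_atlas: "smooth_manifold4 A \<Longrightarrow> c \<in> A \<Longrightarrow> is_chart c"
  by (auto simp: smooth_manifold4_def)

lemma chart_subset_carrier: "(U, \<phi>) \<in> A \<Longrightarrow> U \<subseteq> carrier_of A"
  by (auto simp: carrier_of_def)

lemma smooth_fun_on_subset: "smooth_fun_on A V f \<Longrightarrow> W \<subseteq> V \<Longrightarrow> smooth_fun_on A W f"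
  unfolding smooth_fun_on_def by (fastforce elim: smooth_on_subset)

context
  fixes A :: "'a::{t2_space, second_countable_topology} chart set"
  assumes manifold: "smooth_manifold4 A"
begin

text \<open>The closure rules above are stated on open sets, so every argument made chart by chart
  needs the image of \<open>V\<close> to be open; the rule supplies this along with the chart
  property.\<close>

lemma smooth_fun_onI:
  assumes "open V"
    and "\<And>U \<phi>. (U, \<phi>) \<in> A \<Longrightarrow> is_chart (U, \<phi>) \<Longrightarrow> open (\<phi> ` (U \<inter> V)) \<Longrightarrow>
          smooth_on (\<phi> ` (U \<inter> V)) (\<lambda>y. f (inv_into U \<phi> y))"
  shows "smooth_fun_on A V f"
proof -
  have "smooth_on (\<phi> ` (U \<inter> V)) (f \<circ> inv_into U \<phi>)" if c: "(U, \<phi>) \<in> A" for U \<phi>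
    using assms(2)[OF c chart_in_atlas[OF manifold c]]
      chart_open_image[OF chart_in_atlas[OF manifold c] assms(1)]
    by (simp add: o_def)
  then show ?thesis by (auto simp: smooth_fun_on_def)
qed

lemma smooth_fun_onD:
  "smooth_fun_on A V f \<Longrightarrow> (U, \<phi>) \<in> A \<Longrightarrow> smooth_on (\<phi> ` (U \<inter> V)) (\<lambda>y. f (inv_into U \<phi> y))"
  by (auto simp: smooth_fun_on_def o_def)

lemma smooth_fun_on_const: "open V \<Longrightarrow> smooth_fun_on A V (\<lambda>_. a)"
  by (rule smooth_fun_onI) (auto intro: smooth_on_const)

lemma smooth_fun_on_add:
  "open V \<Longrightarrow> smooth_fun_on A V f \<Longrightarrow> smooth_fun_on A V h \<Longrightarrow> smooth_fun_on A V (\<lambda>q. f q + h q)"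
  by (rule smooth_fun_onI) (auto intro: smooth_on_add smooth_fun_onD)

lemma smooth_fun_on_mult:
  "open V \<Longrightarrow> smooth_fun_on A V f \<Longrightarrow> smooth_fun_on A V h \<Longrightarrow> smooth_fun_on A V (\<lambda>q. f q * h q)"
  by (rule smooth_fun_onI) (auto intro: smooth_on_mult smooth_fun_onD)

lemma smooth_fun_on_diff:
  assumes "open V" "smooth_fun_on A V f" "smooth_fun_on A V h"
  shows "smooth_fun_on A V (\<lambda>q. f q - h q)"
  using smooth_fun_on_add[OF assms(1,2)
      smooth_fun_on_mult[OF assms(1) smooth_fun_on_const[OF assms(1), of "- 1"] assms(3)]]
  by simp

lemma smooth_fun_on_cong:
  assumes "open V" "smooth_fun_on A V f" "\<And>q. q \<in> V \<Longrightarrow> f q = h q"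
  shows "smooth_fun_on A V h"
proof (rule smooth_fun_onI[OF assms(1)])
  fix U \<phi> assume c: "(U, \<phi>) \<in> A" "is_chart (U, \<phi>)" "open (\<phi> ` (U \<inter> V))"
  show "smooth_on (\<phi> ` (U \<inter> V)) (\<lambda>y. h (inv_into U \<phi> y))"
    by (rule smooth_on_cong[OF c(3) _ smooth_fun_onD[OF assms(2) c(1)]])
      (auto simp: assms(3) inv_into_f_f[OF chart_inj[OF c(2)]])
qed

lemma smooth_nearI:
  "open V \<Longrightarrow> x \<in> V \<Longrightarrow> V \<subseteq> carrier_of A \<Longrightarrow> smooth_fun_on A V f \<Longrightarrow> smooth_near A x f"
  by (auto simp: smooth_near_def)

lemma smooth_near_common:
  assumes "smooth_near A x f" "smooth_near A x h"
  obtains V where "open V" "x \<in> V" "V \<subseteq> carrier_of A" "smooth_fun_on A V f" "smooth_fun_on A V h"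
proof -
  obtain V W where "open V" "x \<in> V" "V \<subseteq> carrier_of A" "smooth_fun_on A V f"
    "open W" "x \<in> W" "smooth_fun_on A W h"
    using assms by (auto simp: smooth_near_def)
  then show ?thesis
    using that[of "V \<inter> W"] smooth_fun_on_subset by (metis Int_iff inf_le1 inf_le2 open_Int subset_trans)
qed

lemma smooth_near_cong:
  assumes "open V" "x \<in> V" "\<And>q. q \<in> V \<Longrightarrow> f q = h q" "smooth_near A x f"
  shows "smooth_near A x h"
proof -
  obtain W where W: "open W" "x \<in> W" "W \<subseteq> carrier_of A" "smooth_fun_on A W f"
    using assms(4) by (auto simp: smooth_near_def)
  show ?thesis
  proof (rule smooth_nearI[of "V \<inter> W"])
    show "smooth_fun_on A (V \<inter> W) h"
      by (rule smooth_fun_on_cong[of _ f])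
        (use assms(1,3) W smooth_fun_on_subset[OF W(4)] in auto)
  qed (use assms W in auto)
qed

lemma smooth_near_scale: "smooth_near A x f \<Longrightarrow> smooth_near A x (\<lambda>q. a * f q)"
  unfolding smooth_near_def using smooth_fun_on_mult smooth_fun_on_const by blast

lemma smooth_near_add:
  "smooth_near A x f \<Longrightarrow> smooth_near A x h \<Longrightarrow> smooth_near A x (\<lambda>q. f q + h q)"
  by (erule (1) smooth_near_common) (auto intro: smooth_nearI smooth_fun_on_add)

lemma smooth_near_mult:
  "smooth_near A x f \<Longrightarrow> smooth_near A x h \<Longrightarrow> smooth_near A x (\<lambda>q. f q * h q)"
  by (erule (1) smooth_near_common) (auto intro: smooth_nearI smooth_fun_on_mult)

lemma transition_smooth:
  "(U, \<phi>) \<in> A \<Longrightarrow> (V, \<psi>) \<in> A \<Longrightarrow> smooth_on (\<phi> ` (U \<inter> V)) (\<lambda>y. \<psi> (inv_into U \<phi> y))"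
  using manifold by (fastforce simp: smooth_manifold4_def o_def)

text \<open>Read in another chart, a coordinate function is a component of the transition map, which
  is smooth by the definition of an atlas.\<close>

lemma smooth_coordinate:
  assumes c: "(U, \<phi>) \<in> A"
  shows "smooth_fun_on A U (\<lambda>q. \<phi> q $ b)"
proof (rule smooth_fun_onI)
  show "open U" using chart_in_atlas[OF manifold c] by (simp add: is_chart_def)
  fix V \<psi> assume d: "(V, \<psi>) \<in> A" "open (\<psi> ` (V \<inter> U))"
  show "smooth_on (\<psi> ` (V \<inter> U)) (\<lambda>y. \<phi> (inv_into V \<psi> y) $ b)"
    by (rule smooth_on_bounded_linear[OF d(2) bounded_linear_vec_nth transition_smooth[OF d(1) c]])
qed


section \<open>Tangent vectors and coordinate fields\<close>

lemma tangent_spaceD: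
  assumes "v \<in> tangent_space A x"
  shows tangent_not_smooth: "\<not> smooth_near A x f \<Longrightarrow> v f = 0"
    and tangent_local: "smooth_near A x f \<Longrightarrow> open V \<Longrightarrow> x \<in> V \<Longrightarrow>
      (\<And>q. q \<in> V \<Longrightarrow> f q = h q) \<Longrightarrow> v f = v h"
    and tangent_scale: "smooth_near A x f \<Longrightarrow> v (\<lambda>q. a * f q) = a * v f"
    and tangent_add: "smooth_near A x f \<Longrightarrow> smooth_near A x h \<Longrightarrow> v (\<lambda>q. f q + h q) = v f + v h"
    and tangent_mult: "smooth_near A x f \<Longrightarrow> smooth_near A x h \<Longrightarrow>
      v (\<lambda>q. f q * h q) = f x * v h + h x * v f"
proof -
  note v = assms[unfolded tangent_space_def mem_Collect_eq]
  show "\<not> smooth_near A x f \<Longrightarrow> v f = 0"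
    by (rule v[THEN conjunct1, rule_format])
  show "v f = v h"
    if "smooth_near A x f" "open V" "x \<in> V" "\<And>q. q \<in> V \<Longrightarrow> f q = h q"
    by (rule v[THEN conjunct2, THEN conjunct1, rule_format, of f V h]) (simp add: that)
  show "smooth_near A x f \<Longrightarrow> v (\<lambda>q. a * f q) = a * v f"
    by (rule v[THEN conjunct2, THEN conjunct2, THEN conjunct1, rule_format])
  assume fh: "smooth_near A x f" "smooth_near A x h"
  note * = v[THEN conjunct2, THEN conjunct2, THEN conjunct2, rule_format, OF conjI[OF fh]]
  show "v (\<lambda>q. f q + h q) = v f + v h" "v (\<lambda>q. f q * h q) = f x * v h + h x * v f"
    by (rule *[THEN conjunct1], rule *[THEN conjunct2])
qed

text \<open>
  Both functions may be taken smooth in the locality condition, as smoothness near \<open>x\<close> depends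
  only on the germ.
\<close>

lemma tangent_spaceI:
  assumes "\<And>f. \<not> smooth_near A x f \<Longrightarrow> v f = 0"
    and "\<And>f h V. smooth_near A x f \<Longrightarrow> smooth_near A x h \<Longrightarrow> open V \<Longrightarrow> x \<in> V \<Longrightarrow>
           \<forall>q\<in>V. f q = h q \<Longrightarrow> v f = v h"
    and "\<And>a f. smooth_near A x f \<Longrightarrow> v (\<lambda>q. a * f q) = a * v f"
    and "\<And>f h. smooth_near A x f \<Longrightarrow> smooth_near A x h \<Longrightarrow> v (\<lambda>q. f q + h q) = v f + v h"
    and "\<And>f h. smooth_near A x f \<Longrightarrow> smooth_near A x h \<Longrightarrow>
           v (\<lambda>q. f q * h q) = f x * v h + h x * v f"
  shows "v \<in> tangent_space A x"
  unfolding tangent_space_def mem_Collect_eq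
proof (intro conjI allI impI; (elim conjE)?)
  fix f h V assume *: "smooth_near A x f" "open V" "x \<in> V" "\<forall>q\<in>V. f q = h q"
  then have "smooth_near A x h" using smooth_near_cong[of V x f h] by simp
  with * show "v f = v h" using assms(2) by blast
qed (use assms in simp_all)

section \<open>Linear operations on tangent vectors and vector fields\<close>

lemma tv_add_tangent:
  assumes v: "v \<in> tangent_space A x" and w: "w \<in> tangent_space A x"
  shows "tv_add v w \<in> tangent_space A x"
proof (rule tangent_spaceI)
  fix f h V
  assume "smooth_near A x f" "open V" "x \<in> V" "\<forall>q\<in>V. f q = h q"
  then show "tv_add v w f = tv_add v w h"
    using tangent_local[OF v, of f V h] tangent_local[OF w, of f V h] by (simp add: tv_add_def)
next
  fix f h assume fh: "smooth_near A x f" "smooth_near A x h"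
  show "tv_add v w (\<lambda>q. f q + h q) = tv_add v w f + tv_add v w h"
    unfolding tv_add_def tangent_add[OF v fh] tangent_add[OF w fh] by (simp add: algebra_simps)
  show "tv_add v w (\<lambda>q. f q * h q) = f x * tv_add v w h + h x * tv_add v w f"
    unfolding tv_add_def tangent_mult[OF v fh] tangent_mult[OF w fh] by (simp add: algebra_simps)
next
  fix b f assume f: "smooth_near A x f"
  show "tv_add v w (\<lambda>q. b * f q) = b * tv_add v w f"
    unfolding tv_add_def tangent_scale[OF v f] tangent_scale[OF w f] by (simp add: algebra_simps)
qed (simp add: tv_add_def tangent_not_smooth[OF v] tangent_not_smooth[OF w])

lemma tv_scale_tangent:
  assumes v: "v \<in> tangent_space A x"
  shows "tv_scale a v \<in> tangent_space A x"
proof (rule tangent_spaceI)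
  fix f h V
  assume "smooth_near A x f" "open V" "x \<in> V" "\<forall>q\<in>V. f q = h q"
  then show "tv_scale a v f = tv_scale a v h"
    using tangent_local[OF v, of f V h] by (simp add: tv_scale_def)
next
  fix f h assume fh: "smooth_near A x f" "smooth_near A x h"
  show "tv_scale a v (\<lambda>q. f q + h q) = tv_scale a v f + tv_scale a v h"
    unfolding tv_scale_def tangent_add[OF v fh] by (simp add: algebra_simps)
  show "tv_scale a v (\<lambda>q. f q * h q) = f x * tv_scale a v h + h x * tv_scale a v f"
    unfolding tv_scale_def tangent_mult[OF v fh] by (simp add: algebra_simps)
next
  fix b f assume f: "smooth_near A x f"
  show "tv_scale a v (\<lambda>q. b * f q) = b * tv_scale a v f"
    unfolding tv_scale_def tangent_scale[OF v f] by simp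
qed (simp add: tv_scale_def tangent_not_smooth[OF v])

lemma tv_diff_eq: "tv_diff v w = tv_add v (tv_scale (- 1) w)"
  by (simp add: tv_diff_def tv_add_def tv_scale_def)

lemma tv_diff_tangent:
  "v \<in> tangent_space A x \<Longrightarrow> w \<in> tangent_space A x \<Longrightarrow> tv_diff v w \<in> tangent_space A x"
  by (simp add: tv_diff_eq tv_add_tangent tv_scale_tangent)

text \<open>\<open>Z\<close> is tied to the difference on \<open>U\<close> alone, because the
  intended case is the Lie bracket, which torsion-freeness equates with a difference of covariant
  derivatives only there.\<close>

lemma smooth_vfield_diff:
  assumes "smooth_vfield_on A U X" "smooth_vfield_on A U Y"
    and "\<And>x. x \<in> U \<Longrightarrow> Z x = tv_diff (X x) (Y x)"
  shows "smooth_vfield_on A U Z"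
  unfolding smooth_vfield_on_def
proof (intro conjI ballI allI impI)
  fix x assume "x \<in> U"
  then show "Z x \<in> tangent_space A x"
    using assms tv_diff_tangent by (simp add: smooth_vfield_on_def)
next
  fix V f assume V: "open V \<and> V \<subseteq> U \<and> smooth_fun_on A V f"
  then have "smooth_fun_on A V (\<lambda>x. X x f - Y x f)"
    using assms(1,2) by (intro smooth_fun_on_diff) (simp_all add: smooth_vfield_on_def)
  then show "smooth_fun_on A V (\<lambda>x. Z x f)"
    using V by (rule_tac smooth_fun_on_cong) (auto simp: assms(3) subset_iff tv_diff_def)
qed

section \<open>Coordinate fields of a chart\<close>

lemma chart_differentiable:
  assumes c: "(U, \<phi>) \<in> A" and x: "x \<in> U" and f: "smooth_near A x f"
  shows "(\<lambda>y. f (inv_into U \<phi> y)) differentiable (at (\<phi> x))"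
  using f smooth_fun_onD[OF _ c] smooth_on_differentiable x unfolding smooth_near_def by blast

lemma coord_field_eq:
  "smooth_near A x f \<Longrightarrow> coord_field A (U, \<phi>) a x f
     = frechet_derivative (\<lambda>y. f (inv_into U \<phi> y)) (at (\<phi> x)) (axis a 1)"
  by (simp add: coord_field_def o_def)

lemma coord_field_eqI:
  assumes "smooth_near A x f"
    and "((\<lambda>y. f (inv_into U \<phi> y)) has_derivative f') (at (\<phi> x))"
  shows "coord_field A (U, \<phi>) a x f = f' (axis a 1)"
  using frechet_derivative_at[OF assms(2)] by (simp add: coord_field_eq[OF assms(1)])

text \<open>The derivation laws are the rules for derivatives at \<open>\<phi> x\<close>. Locality
  holds since \<open>\<phi>\<close> maps neighbourhoods of \<open>x\<close> to neighbourhoods of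
  \<open>\<phi> x\<close>, and vanishing on functions that are not smooth is the guard in
  \<open>coord_field\<close>.\<close>

lemma coord_field_tangent:
  assumes c: "(U, \<phi>) \<in> A" and x: "x \<in> U"
  shows "coord_field A (U, \<phi>) a x \<in> tangent_space A x"
proof -
  have ch: "is_chart (U, \<phi>)" by (rule chart_in_atlas[OF manifold c])
  have der: "((\<lambda>y. f (inv_into U \<phi> y)) has_derivative
      frechet_derivative (\<lambda>y. f (inv_into U \<phi> y)) (at (\<phi> x))) (at (\<phi> x))"
    if "smooth_near A x f" for f
    using chart_differentiable[OF c x that] by (simp add: frechet_derivative_works)
  have inv: "inv_into U \<phi> (\<phi> x) = x" using chart_inj[OF ch] x by simp
  show ?thesis
  proof (rule tangent_spaceI)
    fix f h V
    assume fh: "smooth_near A x f" "smooth_near A x h" and V: "open V" "x \<in> V" "\<forall>q\<in>V. f q = h q"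
    have "((\<lambda>y. h (inv_into U \<phi> y)) has_derivative
      frechet_derivative (\<lambda>y. f (inv_into U \<phi> y)) (at (\<phi> x))) (at (\<phi> x))"
      by (rule has_derivative_transform_within_open[OF der[OF fh(1)] chart_open_image[OF ch V(1)]])
        (use x V in \<open>auto simp: inv_into_f_f[OF chart_inj[OF ch]]\<close>)
    from coord_field_eqI[OF fh(2) this]
    show "coord_field A (U, \<phi>) a x f = coord_field A (U, \<phi>) a x h"
      by (simp add: coord_field_eq fh)
  next
    fix b f assume f: "smooth_near A x f"
    show "coord_field A (U, \<phi>) a x (\<lambda>q. b * f q) = b * coord_field A (U, \<phi>) a x f"
      using coord_field_eqI[OF smooth_near_scale[OF f] has_derivative_mult_right[OF der[OF f]]]
      by (simp add: coord_field_eq f)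
  next
    fix f h assume f: "smooth_near A x f" and h: "smooth_near A x h"
    show "coord_field A (U, \<phi>) a x (\<lambda>q. f q + h q)
        = coord_field A (U, \<phi>) a x f + coord_field A (U, \<phi>) a x h"
      using coord_field_eqI[OF smooth_near_add[OF f h] has_derivative_add[OF der[OF f] der[OF h]]]
      by (simp add: coord_field_eq f h)
    show "coord_field A (U, \<phi>) a x (\<lambda>q. f q * h q)
        = f x * coord_field A (U, \<phi>) a x h + h x * coord_field A (U, \<phi>) a x f"
      using coord_field_eqI[OF smooth_near_mult[OF f h] has_derivative_mult[OF der[OF f] der[OF h]]]
      by (simp add: coord_field_eq f h inv)
  qed (simp add: coord_field_def)
qed

text \<open>In a chart \<open>\<psi>\<close> the function is the partial derivative of
  \<open>f\<close> in the chart \<open>\<phi>\<close>, composed with the transition map.\<close>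

lemma coord_field_smooth:
  assumes c: "(U, \<phi>) \<in> A"
  shows "smooth_vfield_on A U (coord_field A (U, \<phi>) a)"
  unfolding smooth_vfield_on_def
proof (intro conjI ballI allI impI coord_field_tangent[OF c])
  have ch: "is_chart (U, \<phi>)" by (rule chart_in_atlas[OF manifold c])
  fix V f assume V: "open V \<and> V \<subseteq> U \<and> smooth_fun_on A V f"
  show "smooth_fun_on A V (\<lambda>x. coord_field A (U, \<phi>) a x f)"
  proof (rule smooth_fun_onI)
    fix W \<psi> assume d: "(W, \<psi>) \<in> A" "is_chart (W, \<psi>)" "open (\<psi> ` (W \<inter> V))"
    let ?F = "\<lambda>z. frechet_derivative (\<lambda>y. f (inv_into U \<phi> y)) (at z) (axis a 1)"
    have "smooth_on (\<psi> ` (W \<inter> V)) (\<lambda>y. ?F (\<phi> (inv_into W \<psi> y)))"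
    proof (rule smooth_on_compose[OF d(3), where f = "\<lambda>y. \<phi> (inv_into W \<psi> y)" and h = ?F])
      show "open (\<phi> ` (U \<inter> V))" using chart_open_image[OF ch] V by blast
      show "(\<lambda>y. \<phi> (inv_into W \<psi> y)) ` \<psi> ` (W \<inter> V) \<subseteq> \<phi> ` (U \<inter> V)"
        using V by (auto simp: inv_into_f_f[OF chart_inj[OF d(2)]])
      show "smooth_on (\<psi> ` (W \<inter> V)) (\<lambda>y. \<phi> (inv_into W \<psi> y))"
        by (rule smooth_on_subset[OF transition_smooth[OF d(1) c]]) (use V in auto)
      show "smooth_on (\<phi> ` (U \<inter> V)) ?F"
        using smooth_on_derivative smooth_fun_onD[OF _ c] V by blast
    qed
    then show "smooth_on (\<psi> ` (W \<inter> V)) (\<lambda>y. coord_field A (U, \<phi>) a (inv_into W \<psi> y) f)"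
    proof (rule smooth_on_cong[OF d(3), rotated])
      fix y assume "y \<in> \<psi> ` (W \<inter> V)"
      then have "inv_into W \<psi> y \<in> V" by (auto simp: inv_into_f_f[OF chart_inj[OF d(2)]])
      then have "smooth_near A (inv_into W \<psi> y) f"
        using V chart_subset_carrier[OF c] by (intro smooth_nearI[of V]) auto
      then show "?F (\<phi> (inv_into W \<psi> y)) = coord_field A (U, \<phi>) a (inv_into W \<psi> y) f"
        by (simp add: coord_field_eq)
    qed
  qed (use V in blast)
qed

text \<open>In its own chart the coordinate function is a linear projection, hence its own
  derivative. This duality yields the linear independence of the coordinate frame.\<close>

lemma coord_field_coordinate:
  assumes c: "(U, \<phi>) \<in> A" and x: "x \<in> U"
  shows "coord_field A (U, \<phi>) a x (\<lambda>q. \<phi> q $ b) = (if a = b then 1 else 0)"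
proof -
  have ch: "is_chart (U, \<phi>)" by (rule chart_in_atlas[OF manifold c])
  then have U: "open U" "open (\<phi> ` U)" by (auto simp: is_chart_def)
  have "smooth_near A x (\<lambda>q. \<phi> q $ b)"
    using smooth_nearI[OF U(1) x chart_subset_carrier[OF c] smooth_coordinate[OF c]] .
  moreover have "((\<lambda>y. \<phi> (inv_into U \<phi> y) $ b) has_derivative (\<lambda>v. v $ b)) (at (\<phi> x))"
  proof (rule has_derivative_transform_within_open[OF _ U(2)])
    show "((\<lambda>y. y $ b) has_derivative (\<lambda>v. v $ b)) (at (\<phi> x))"
      by (rule bounded_linear_imp_has_derivative[OF bounded_linear_vec_nth])
  qed (use x in \<open>auto simp: inv_into_f_f[OF chart_inj[OF ch]]\<close>)
  ultimately show ?thesis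
    by (simp add: coord_field_eqI axis_def)
qed

section \<open>The metric in coordinates\<close>

context
  fixes g :: "'a metric"
  assumes metric: "lorentzian_metric A g"
begin

lemma metric_bilinear:
  assumes "x \<in> carrier_of A" "v \<in> tangent_space A x" "w \<in> tangent_space A x"
  shows metric_sym: "g x v w = g x w v"
    and metric_scale: "g x (tv_scale a v) w = a * g x v w"
    and metric_add: "v' \<in> tangent_space A x \<Longrightarrow> g x (tv_add v v') w = g x v w + g x v' w"
proof -
  note m = metric[unfolded lorentzian_metric_def, THEN conjunct1, THEN bspec, OF assms(1)]
  show "g x v w = g x w v"
    by (rule m[THEN conjunct1, rule_format, OF assms(2,3)])
  show "g x (tv_scale a v) w = a * g x v w"
    by (rule m[THEN conjunct2, THEN conjunct2, THEN conjunct1, rule_format, OF assms(2,3)])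
  show "v' \<in> tangent_space A x \<Longrightarrow> g x (tv_add v v') w = g x v w + g x v' w"
    by (rule m[THEN conjunct2, THEN conjunct1, rule_format, OF assms(2) _ assms(3)])
qed

lemma metric_diff:
  assumes "x \<in> carrier_of A" "v \<in> tangent_space A x" "v' \<in> tangent_space A x"
    "w \<in> tangent_space A x"
  shows "g x (tv_diff v v') w = g x v w - g x v' w"
  using assms by (simp add: tv_diff_eq metric_add metric_scale tv_scale_tangent)

text \<open>\<open>g\<close> is linear only on tangent vectors, so the induction has to carry
  membership of the partial sums along with the formula.\<close>

lemma metric_sum:
  assumes x: "x \<in> carrier_of A" and w: "w \<in> tangent_space A x"
    and e: "\<And>i. e i \<in> tangent_space A x" and I: "finite I"
  shows "(\<lambda>f. \<Sum>i\<in>I. c i * e i f) \<in> tangent_space A x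
    \<and> g x (\<lambda>f. \<Sum>i\<in>I. c i * e i f) w = (\<Sum>i\<in>I. c i * g x (e i) w)"
  using I
proof (induction I rule: finite_induct)
  case empty
  \<comment> \<open>The empty sum is the zero vector, written as a multiple of \<open>w\<close> so
    that homogeneity gives its product with \<open>w\<close>.\<close>
  have "(\<lambda>f. \<Sum>i\<in>{}. c i * e i f) = tv_scale 0 w" by (simp add: tv_scale_def)
  then show ?case using metric_scale[OF x w w, of 0] tv_scale_tangent[OF w, of 0] by simp
next
  case (insert j I)
  have "(\<lambda>f. \<Sum>i\<in>insert j I. c i * e i f)
      = tv_add (tv_scale (c j) (e j)) (\<lambda>f. \<Sum>i\<in>I. c i * e i f)"
    using insert.hyps by (simp add: tv_scale_def tv_add_def)
  then show ?case
    using insert x w e by (simp add: metric_add metric_scale tv_add_tangent tv_scale_tangent)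
qed

lemma metric_lo_sym:
  assumes "(U, \<phi>) \<in> A" "x \<in> U"
  shows "metric_lo A g (U, \<phi>) x $ a $ b = metric_lo A g (U, \<phi>) x $ b $ a"
  using metric_sym coord_field_tangent[OF assms] chart_subset_carrier[OF assms(1)] assms(2)
  by (auto simp: metric_lo_def)

text \<open>
  With \<open>C\<close> the matrix of the coordinate frame in a pseudo-orthonormal basis and \<open>\<eta>\<close> the Minkowski
  matrix, the metric is \<open>C \<eta> C\<^sup>T\<close>. The rows of \<open>C\<close> are independent since the differentials of the
  coordinates are dual to the coordinate frame.
\<close>

lemma metric_lo_invertible:
  assumes c: "(U, \<phi>) \<in> A" and x: "x \<in> U"
  shows "invertible (metric_lo A g (U, \<phi>) x)"
proof -
  let ?d = "\<lambda>a. coord_field A (U, \<phi>) a x"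
  have xc: "x \<in> carrier_of A" using chart_subset_carrier[OF c] x by blast
  have d: "?d a \<in> tangent_space A x" for a by (rule coord_field_tangent[OF c x])
  obtain e :: "4 \<Rightarrow> 'a tvector" where frame: "(\<forall>a. e a \<in> tangent_space A x) \<and>
      (\<forall>v\<in>tangent_space A x. \<exists>!c :: real^4. v = (\<lambda>f. \<Sum>a\<in>UNIV. c $ a * e a f)) \<and>
      (\<forall>a b. g x (e a) (e b) = minkowski a b)"
    using metric[unfolded lorentzian_metric_def, THEN conjunct1, THEN bspec, OF xc,
        THEN conjunct2, THEN conjunct2, THEN conjunct2] by (elim exE)
  note e = frame[THEN conjunct1, rule_format]
    and span = frame[THEN conjunct2, THEN conjunct1, THEN bspec, THEN ex1_implies_ex]
    and eta = frame[THEN conjunct2, THEN conjunct2, rule_format]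
  have "\<exists>C. \<forall>a. ?d a = (\<lambda>f. \<Sum>b\<in>UNIV. (C a :: real^4) $ b * e b f)"
    using span[OF d] by (intro choice) blast
  then obtain C where C: "\<And>a. ?d a = (\<lambda>f. \<Sum>b\<in>UNIV. (C a :: real^4) $ b * e b f)"
    by blast
  define M where "M = (\<chi> a. C a)"
  define H :: "real^4^4" where "H = (\<chi> a b. minkowski a b)"
  have left: "g x (?d a) w = (\<Sum>b\<in>UNIV. C a $ b * g x (e b) w)" if "w \<in> tangent_space A x" for a w
    unfolding C by (rule metric_sum[OF xc that, where e = e, OF e finite, THEN conjunct2])
  have "g x (?d a) (?d b) = (\<Sum>i\<in>UNIV. C a $ i * (\<Sum>j\<in>UNIV. C b $ j * minkowski j i))" for a b
  proof -
    \<comment> \<open>Linearity is stated in the first argument, so the second is expanded through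
      symmetry; this reverses the indices of \<open>minkowski\<close> and produces
      \<open>transpose H\<close> below.\<close>
    have "g x (e i) (?d b) = (\<Sum>j\<in>UNIV. C b $ j * minkowski j i)" for i
      using metric_sym[OF xc e d] left[OF e] eta by simp
    then show ?thesis using left[OF d] by simp
  qed
  then have "metric_lo A g (U, \<phi>) x = M ** (transpose H ** transpose M)"
    by (simp add: vec_eq_iff metric_lo_def matrix_matrix_mult_def transpose_def M_def H_def mult.commute)
  \<comment> \<open>The Minkowski matrix is diagonal with entries -1 and 1, hence its own
    inverse.\<close>
  moreover have "H ** H = mat 1"
  proof -
    have "minkowski a b = (if b = a then (if a = 0 then - 1 else 1) else 0)" for a b
      by (simp add: minkowski_def)
    then show ?thesis
      by (simp add: vec_eq_iff H_def matrix_matrix_mult_def mat_def if_distrib[of "\<lambda>y. y * _"]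
          cong: if_cong)
  qed
  then have "invertible H" by (auto simp: invertible_def)
  moreover have "invertible (transpose M)"
  proof -
    have "z = 0" if z: "transpose M *v z = 0" for z
    proof -
      have col: "(\<Sum>a\<in>UNIV. C a $ b * z $ a) = 0" for b
        using arg_cong[OF z, of "\<lambda>v. v $ b"]
        by (simp add: matrix_vector_mult_def transpose_def M_def)
      have "z $ j = 0" for j
      proof -
        let ?f = "\<lambda>q. \<phi> q $ j"
        have "z $ j = (\<Sum>a\<in>UNIV. z $ a * ?d a ?f)"
          by (simp add: coord_field_coordinate[OF c x] if_distrib[of "\<lambda>y. _ * y"] cong: if_cong)
        also have "\<dots> = (\<Sum>a\<in>UNIV. \<Sum>b\<in>UNIV. C a $ b * z $ a * e b ?f)"
          by (simp add: C sum_distrib_left ac_simps)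
        also have "\<dots> = (\<Sum>b\<in>UNIV. (\<Sum>a\<in>UNIV. C a $ b * z $ a) * e b ?f)"
          by (subst sum.swap) (simp add: sum_distrib_right)
        finally show ?thesis by (simp add: col)
      qed
      then show ?thesis by (simp add: vec_eq_iff)
    qed
    then show ?thesis
      using matrix_left_invertible_ker[of "transpose M"] invertible_left_inverse by blast
  qed
  ultimately show ?thesis
    by (metis invertible_mult transpose_invertible transpose_transpose)
qed

text \<open>\<open>matrix_inv\<close> chooses some two-sided inverse, and invertibility ensures that
  there is one.\<close>

lemma metric_up_inverse:
  assumes "(U, \<phi>) \<in> A" "x \<in> U"
  shows "metric_lo A g (U, \<phi>) x ** metric_up A g (U, \<phi>) x = mat 1"
    and "metric_up A g (U, \<phi>) x ** metric_lo A g (U, \<phi>) x = mat 1"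
  using someI_ex[OF metric_lo_invertible[OF assms, unfolded invertible_def]]
  by (simp_all add: metric_up_def matrix_inv_def)


section \<open>Skew symmetry of the Riemann tensor\<close>

context
  fixes D :: "'a connection" and U :: "'a set"
  assumes lc: "levi_civita A g D"
    and U: "open U" "U \<subseteq> carrier_of A"
begin

lemma connection_smooth:
  "smooth_vfield_on A U X \<Longrightarrow> smooth_vfield_on A U Y \<Longrightarrow> smooth_vfield_on A U (D X Y)"
  \<comment> \<open>The axioms of a connection share one premise on \<open>X\<close>,
    \<open>Y\<close>, \<open>Z\<close> and \<open>h\<close>; here \<open>Z\<close> is taken to be
    \<open>X\<close>, and \<open>h\<close> to be zero.\<close>
  by (rule lc[unfolded levi_civita_def affine_connection_def, THEN conjunct1, THEN conjunct1,
        rule_format, THEN conjunct1, of U X Y X "\<lambda>_. 0"])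
    (simp add: U smooth_fun_on_const)

lemma
  assumes "smooth_vfield_on A U X" "smooth_vfield_on A U Y" "x \<in> U"
  shows torsion_free: "tv_diff (D X Y x) (D Y X x) = lie_bracket A X Y x"
    and metric_compatible: "smooth_vfield_on A U Z \<Longrightarrow>
      X x (\<lambda>q. g q (Y q) (Z q)) = g x (D X Y x) (Z x) + g x (Y x) (D X Z x)"
proof -
  note l = lc[unfolded levi_civita_def, THEN conjunct2, rule_format]
  show "tv_diff (D X Y x) (D Y X x) = lie_bracket A X Y x"
    by (rule l[THEN conjunct1, of U X Y X]) (simp_all add: assms U)
  show "X x (\<lambda>q. g q (Y q) (Z q)) = g x (D X Y x) (Z x) + g x (Y x) (D X Z x)"
    if "smooth_vfield_on A U Z"
    by (rule l[THEN conjunct2, of U X Y Z]) (simp_all add: assms U that)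
qed

text \<open>Torsion-freeness makes the bracket a difference of two smooth covariant derivatives,
  which avoids checking by hand that a commutator of derivations is again a derivation.\<close>

lemma lie_bracket_smooth:
  assumes "smooth_vfield_on A U X" "smooth_vfield_on A U Y"
  shows "smooth_vfield_on A U (lie_bracket A X Y)"
  by (rule smooth_vfield_diff[of U "D X Y" "D Y X"])
    (use assms in \<open>simp_all add: connection_smooth torsion_free\<close>)

lemma inner_product_smooth:
  "smooth_vfield_on A U X \<Longrightarrow> smooth_vfield_on A U Y \<Longrightarrow> smooth_fun_on A U (\<lambda>q. g q (X q) (Y q))"
  by (rule metric[unfolded lorentzian_metric_def, THEN conjunct2, rule_format]) (simp add: U)

text \<open>Metric compatibility is applied to \<open>Y\<close> and then, term by term, to
  \<open>X\<close>. The first use holds only on \<open>U\<close>; since \<open>X x\<close> depends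
  on the germ at \<open>x\<close> alone, the result may be substituted under
  \<open>X x\<close>.\<close>

lemma inner_product_second_derivative:
  assumes X: "smooth_vfield_on A U X" and Y: "smooth_vfield_on A U Y"
    and Z: "smooth_vfield_on A U Z" and T: "smooth_vfield_on A U T" and x: "x \<in> U"
  shows "X x (\<lambda>q. Y q (\<lambda>r. g r (Z r) (T r))) =
    g x (D X (D Y Z) x) (T x) + g x (D Y Z x) (D X T x)
    + (g x (D X Z x) (D Y T x) + g x (Z x) (D X (D Y T) x))"
proof -
  note smooth = X Y Z T connection_smooth
  have near: "smooth_near A x (\<lambda>q. g q (V q) (W q))"
    if "smooth_vfield_on A U V" "smooth_vfield_on A U W" for V W
    using smooth_nearI[OF U(1) x U(2) inner_product_smooth[OF that]] .
  have Xx: "X x \<in> tangent_space A x" using X x by (simp add: smooth_vfield_on_def)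
  have "X x (\<lambda>q. g q (D Y Z q) (T q) + g q (Z q) (D Y T q))
      = X x (\<lambda>q. Y q (\<lambda>r. g r (Z r) (T r)))"
    by (rule tangent_local[OF Xx smooth_near_add[OF near near] U(1) x])
      (simp_all add: smooth metric_compatible)
  moreover have "X x (\<lambda>q. g q (D Y Z q) (T q) + g q (Z q) (D Y T q))
      = X x (\<lambda>q. g q (D Y Z q) (T q)) + X x (\<lambda>q. g q (Z q) (D Y T q))"
    by (rule tangent_add[OF Xx near near]) (simp_all add: smooth)
  ultimately show ?thesis
    using x by (simp add: smooth metric_compatible)
qed

text \<open>The bracket of \<open>X\<close> and \<open>Y\<close> acts on the inner product of
  \<open>Z\<close> and \<open>T\<close> in two ways. As a commutator of second derivatives, its
  mixed terms, which pair a derivative of \<open>Z\<close> with one of \<open>T\<close>, are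
  symmetric in \<open>X\<close> and \<open>Y\<close> and cancel. By metric compatibility it gives
  the terms with \<open>D (lie_bracket A X Y)\<close>. Equating the two is the claim.\<close>

lemma riemann_skew:
  assumes X: "smooth_vfield_on A U X" and Y: "smooth_vfield_on A U Y"
    and Z: "smooth_vfield_on A U Z" and T: "smooth_vfield_on A U T" and x: "x \<in> U"
  shows "riemann A g D X Y Z T x + riemann A g D X Y T Z x = 0"
proof -
  have xc: "x \<in> carrier_of A" using U(2) x by blast
  have in_tangent: "V x \<in> tangent_space A x" if "smooth_vfield_on A U V" for V
    using that x by (simp add: smooth_vfield_on_def)
  note smooth = X Y Z T connection_smooth lie_bracket_smooth
  have R: "riemann A g D X Y V W x
      = g x (D X (D Y V) x) (W x) - g x (D Y (D X V) x) (W x) - g x (D (lie_bracket A X Y) V x) (W x)"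
    if "smooth_vfield_on A U V" "smooth_vfield_on A U W" for V W
    by (simp add: riemann_def metric_diff xc tv_diff_tangent in_tangent smooth that)
  have sym: "g x (V x) (W x) = g x (W x) (V x)"
    if "smooth_vfield_on A U V" "smooth_vfield_on A U W" for V W
    using that by (intro metric_sym xc in_tangent)
  \<comment> \<open>Smoothness of the inner product discharges the guard in
    \<open>lie_bracket\<close>.\<close>
  have "smooth_near A x (\<lambda>q. g q (Z q) (T q))"
    by (rule smooth_nearI[OF U(1) x U(2) inner_product_smooth[OF Z T]])
  then have "lie_bracket A X Y x (\<lambda>q. g q (Z q) (T q))
      = X x (\<lambda>q. Y q (\<lambda>r. g r (Z r) (T r))) - Y x (\<lambda>q. X q (\<lambda>r. g r (Z r) (T r)))"
    by (simp add: lie_bracket_def)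
  moreover have "lie_bracket A X Y x (\<lambda>q. g q (Z q) (T q))
      = g x (D (lie_bracket A X Y) Z x) (T x) + g x (Z x) (D (lie_bracket A X Y) T x)"
    by (rule metric_compatible) (simp_all add: smooth x)
  moreover have "g x (Z x) (V x) = g x (V x) (Z x)" if "smooth_vfield_on A U V" for V
    by (rule sym[OF Z that])
  ultimately show ?thesis
    by (simp add: R smooth inner_product_second_derivative x)
qed

end

lemma Riem_skew:
  assumes "levi_civita A g D" "(U, \<phi>) \<in> A" "x \<in> U"
  shows "Riem A g D (U, \<phi>) x a b i j + Riem A g D (U, \<phi>) x a b j i = 0"
  unfolding Riem_def
  using chart_in_atlas[OF manifold assms(2)] assms
  by (intro riemann_skew[of D U])
    (auto simp: is_chart_def intro: chart_subset_carrier[THEN subsetD] coord_field_smooth)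

end

end


section \<open>Contractions\<close>

lemma matrix_mult_nth: "(A ** B) $ i $ j = (\<Sum>k\<in>UNIV. A $ i $ k * B $ k $ j)"
  by (simp add: matrix_matrix_mult_def)

lemma contract_inverse:
  fixes M N :: "real^'n^'n"
  assumes "M ** N = mat 1"
  shows "(\<Sum>k\<in>UNIV. M $ i $ k * N $ k $ j) = (if i = j then 1 else 0)"
  using arg_cong[OF assms, of "\<lambda>B. B $ i $ j"] by (simp add: matrix_mult_nth mat_def)

lemma trace_inverse:
  fixes M N :: "real^'n^'n"
  assumes sym: "\<And>a b. M $ a $ b = M $ b $ a" and inv: "N ** M = mat 1"
  shows "(\<Sum>a\<in>UNIV. \<Sum>i\<in>UNIV. N $ a $ i * M $ a $ i) = real CARD('n)"
proof -
  have "(\<Sum>i\<in>UNIV. N $ a $ i * M $ a $ i) = 1" for a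
    unfolding sym[of a] by (simp add: contract_inverse[OF inv])
  then show ?thesis by simp
qed

lemma einstein_of_skew:
  fixes M N :: "real^'n^'n" and R :: "'n \<Rightarrow> 'n \<Rightarrow> real"
  assumes sym: "\<And>a b. M $ a $ b = M $ b $ a"
    and inv: "M ** N = mat 1" "N ** M = mat 1"
    and skew: "\<And>a b i j. M $ a $ i * R b j - M $ b $ i * R a j
                 + (M $ a $ j * R b i - M $ b $ j * R a i) = 0"
  shows "real CARD('n) * R b j = (\<Sum>a\<in>UNIV. \<Sum>i\<in>UNIV. N $ a $ i * R a i) * M $ b $ j"
proof -
  have 1: "(\<Sum>a\<in>UNIV. \<Sum>i\<in>UNIV. N $ a $ i * M $ a $ i * R b j) = real CARD('n) * R b j"
    by (simp add: sum_distrib_right[symmetric] trace_inverse[OF sym inv(2)])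
  have 2: "(\<Sum>a\<in>UNIV. \<Sum>i\<in>UNIV. N $ a $ i * M $ b $ i * R a j) = R b j"
    unfolding sym[of b]
    by (simp add: sum_distrib_right[symmetric] contract_inverse[OF inv(2)]
        if_distrib[of "\<lambda>y. y * _"] cong: if_cong)
  \<comment> \<open>Here the first index of \<open>N\<close> is contracted. Only \<open>M\<close> is
    given as symmetric, so this uses \<open>M ** N\<close> where the previous sum used
    \<open>N ** M\<close>.\<close>
  have "(\<Sum>a\<in>UNIV. N $ a $ i * M $ a $ j * R b i) = (if j = i then R b i else 0)" for i
    using arg_cong[OF contract_inverse[OF inv(1), of j i], of "\<lambda>y. y * R b i"]
    by (simp add: sum_distrib_right sym[of j] mult.commute[of "M $ _ $ j"])
  then have 3: "(\<Sum>a\<in>UNIV. \<Sum>i\<in>UNIV. N $ a $ i * M $ a $ j * R b i) = R b j"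
    by (subst sum.swap) simp
  have "0 = (\<Sum>a\<in>UNIV. \<Sum>i\<in>UNIV. N $ a $ i * (M $ a $ i * R b j - M $ b $ i * R a j
      + (M $ a $ j * R b i - M $ b $ j * R a i)))"
    by (simp add: skew)
  also have "\<dots> = (\<Sum>a\<in>UNIV. \<Sum>i\<in>UNIV. N $ a $ i * M $ a $ i * R b j)
      - (\<Sum>a\<in>UNIV. \<Sum>i\<in>UNIV. N $ a $ i * M $ b $ i * R a j)
      + ((\<Sum>a\<in>UNIV. \<Sum>i\<in>UNIV. N $ a $ i * M $ a $ j * R b i)
      - (\<Sum>a\<in>UNIV. \<Sum>i\<in>UNIV. N $ a $ i * R a i * M $ b $ j))"
    by (simp add: sum.distrib sum_subtractf algebra_simps)
  finally show ?thesis
    by (simp add: 1 2 3 sum_distrib_right)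
qed

text \<open>In dimension n, contracting \<open>eq\<close> with \<open>N\<close> gives
  \<open>n * s = - K\<close>, and contracting it with \<open>u\<close> gives
  \<open>s * w a = - K * w a\<close>, where \<open>w\<close> is nonzero by \<open>unit\<close>.
  Together \<open>(n - 1) * K = 0\<close>. In dimension one every metric has rank one, which is what
  \<open>card\<close> excludes.\<close>

lemma metric_not_rank_one:
  fixes M N :: "real^'n^'n" and u w :: "'n \<Rightarrow> real"
  assumes card: "CARD('n) \<noteq> 1"
    and sym: "\<And>a b. M $ a $ b = M $ b $ a" and inv: "N ** M = mat 1"
    and w: "\<And>a. w a = (\<Sum>b\<in>UNIV. M $ a $ b * u b)"
    and unit: "(\<Sum>a\<in>UNIV. w a * u a) = - 1"
    and eq: "\<And>a b. s * M $ a $ b = K * w a * w b"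
  shows "K = 0"
proof -
  \<comment> \<open>Raising the index of \<open>w\<close> recovers \<open>u\<close>.\<close>
  have Nw: "(\<Sum>i\<in>UNIV. N $ a $ i * w i) = u a" for a
  proof -
    have "(\<Sum>i\<in>UNIV. N $ a $ i * w i) = (\<Sum>b\<in>UNIV. (\<Sum>i\<in>UNIV. N $ a $ i * M $ i $ b) * u b)"
      unfolding w sum_distrib_left sum_distrib_right
      by (subst sum.swap) (simp add: ac_simps)
    then show ?thesis
      by (simp add: contract_inverse[OF inv] if_distrib[of "\<lambda>y. y * _"] cong: if_cong)
  qed
  have "s * real CARD('n) = (\<Sum>a\<in>UNIV. \<Sum>i\<in>UNIV. N $ a $ i * (s * M $ a $ i))"
    by (simp add: trace_inverse[OF sym inv, symmetric] sum_distrib_left ac_simps)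
  also have "\<dots> = (\<Sum>a\<in>UNIV. K * w a * (\<Sum>i\<in>UNIV. N $ a $ i * w i))"
    by (simp add: eq sum_distrib_left ac_simps)
  also have "\<dots> = K * (\<Sum>a\<in>UNIV. w a * u a)"
    unfolding Nw by (simp add: sum_distrib_left ac_simps)
  finally have n: "s * real CARD('n) = - K" by (simp add: unit)
  have "s * w a = - (K * w a)" for a
  proof -
    have "s * w a = (\<Sum>b\<in>UNIV. (s * M $ a $ b) * u b)"
      by (simp add: w sum_distrib_left ac_simps)
    also have "\<dots> = K * w a * (\<Sum>b\<in>UNIV. w b * u b)"
      by (simp add: eq sum_distrib_left ac_simps)
    finally show ?thesis by (simp add: unit)
  qed
  moreover obtain a where "w a \<noteq> 0"
    using unit by (metis (no_types, lifting) mult_zero_left neg_equal_0_iff_equal sum.neutral zero_neq_one)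
  ultimately have "s = - K" by (metis mult_minus_left mult_right_cancel)
  with n have "K * (real CARD('n) - 1) = 0" by (simp add: algebra_simps)
  with card show ?thesis by simp
qed

theorem theorem3p4:
  fixes A :: "'a::{t2_space, second_countable_topology} chart set"
    and g :: "'a metric" and D :: "'a connection"
    and \<mu> p :: "'a \<Rightarrow> real" and u :: "'a vfield" and \<Lambda> k :: real
  assumes "smooth_manifold4 A"
    and "lorentzian_metric A g"
    and "levi_civita A g D"
    and "W_flat A g D"
    and "k \<noteq> 0"
    and "fluid_velocity A g u"
    and "einstein_equations A g D \<Lambda> k (perfect_fluid A g \<mu> p u)"
  shows "\<forall>x\<in>carrier_of A. \<mu> x + p x = 0"
proof
  fix x assume "x \<in> carrier_of A"
  then obtain U \<phi> where c: "(U, \<phi>) \<in> A" "x \<in> U"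
    by (auto simp: carrier_of_def)
  let ?M = "metric_lo A g (U, \<phi>) x" and ?N = "metric_up A g (U, \<phi>) x"
    and ?R = "Ricci A g D (U, \<phi>) x" and ?S = "scalar_curvature A g D (U, \<phi>) x"
    and ?w = "vec_lo A g u (U, \<phi>) x" and ?u = "vec_up u (U, \<phi>) x"
  note sym = metric_lo_sym[OF assms(1,2) c]
  note inv = metric_up_inverse[OF assms(1,2) c]
  have "?M $ a $ i * ?R b j - ?M $ b $ i * ?R a j + (?M $ a $ j * ?R b i - ?M $ b $ j * ?R a i) = 0"
    for a b i j
  proof -
    have "W_curvature A g D (U, \<phi>) x a b i j = 0" "W_curvature A g D (U, \<phi>) x a b j i = 0"
      using assms(4) c by (fastforce simp: W_flat_def)+
    \<comment> \<open>In the sum of the two components the common factor 1/3 divides out.\<close>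
    then show ?thesis
      using Riem_skew[OF assms(1,2,3) c, of a b i j]
      unfolding W_curvature_def by argo
  qed
  from einstein_of_skew[OF sym inv this]
  have ricci: "4 * ?R b i = ?S * ?M $ b $ i" for b i
    by (simp add: scalar_curvature_def)
  \<comment> \<open>By \<open>ricci\<close> the Ricci term is \<open>?S / 4\<close> times the
    metric; with the term \<open>- ?S / 2\<close> it leaves \<open>- ?S / 4\<close>. The pressure
    term is moved to the left.\<close>
  have "(\<Lambda> - ?S / 4 - k * p x) * ?M $ b $ i = k * (\<mu> x + p x) * ?w b * ?w i" for b i
  proof -
    have "?R b i - 1 / 2 * ?S * ?M $ b $ i + \<Lambda> * ?M $ b $ i
        = k * ((\<mu> x + p x) * ?w b * ?w i + p x * ?M $ b $ i)"
      using assms(7) c by (fastforce simp: einstein_equations_def perfect_fluid_def)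
    then show ?thesis using ricci[of b i] by (simp add: algebra_simps)
  qed
  moreover have "(\<Sum>a\<in>UNIV. ?w a * ?u a) = - 1"
    using assms(6) c by (fastforce simp: fluid_velocity_def)
  ultimately have "k * (\<mu> x + p x) = 0"
    by (intro metric_not_rank_one[OF _ sym inv(2), of ?w ?u]) (simp_all add: vec_lo_def)
  then show "\<mu> x + p x = 0" using assms(5) by simp
qed

end
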